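(* Let $G$ be a finite, connected, simple undirected graph with vertex set $V=\{v_0,\dots,v_n\}$ and edge set $E$, with $v_0$ chosen as sink. Let $\widetilde{V}=V\setminus\{v_0\}$, $X=\{v\in\widetilde{V}:\{v,v_0\}\notin E\}$, $1_X=\sum_{v\in X}v$, and let $K(G)_0$ be the graph $G$ with an edge $\{v,v_0\}$ added for each $v\in X$, with sink $v_0$. (1) Let $\mathcal{S}_0=\{c\in\mathcal{S}: c_{v_0}=-1 \text{ and } c+v_0\ge-1_X\}$. Then $$\psi(\mathbb{O}_0)=\{\tilde c-v_0:\ \tilde c\in\mathbb{Z}\widetilde V,\ \tilde c+1_X \text{ is a superstable configuration on } K(G)_0\}=\mathcal{S}_0.$$ (2) Let $\widetilde{\mathcal{S}}_0=\{c\in\mathcal{S}: c_{v_0}=-1\text{ and } c+v_0\ge0\}\subseteq\mathcal{S}_0$. Then $$\psi(\widetilde{\mathbb{O}}_0)=\{\tilde c-v_0:\ \tilde c \text{ a superstable configuration on } G\}=\{\tilde c-v_0:\ \tilde c+1_X\text{ superstable on }K(G)_0,\ \tilde c\ge0\}=\widetilde{\mathcal{S}}_0.$$ In particular $\psi(\widetilde{\mathbb{O}}_0)=\widetilde{\mathcal{S}}_0$ is the set of $G$-parking functions with respect to $v_0$.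
   Context: Sandpiles: for a graph $H$ with a chosen sink $s$, a configuration is an integer vector indexed by the nonsink vertices (identified with elements of the free abelian group on them); firing a set $Y$ of nonsink vertices from $c$ gives $c-\widetilde{\Delta}1_Y$, where $\widetilde{\Delta}$ is the Laplacian $D-A$ of $H$ with the sink's row and column removed. A configuration $c\ge0$ is superstable if there is no nonempty set $Y$ of nonsink vertices with $c-\widetilde{\Delta}1_Y\ge0$. Inequalities between divisors/configurations are componentwise. A divisor on $G$ is an element of $\mathbb{Z}V$; configurations on $G$ (sink $v_0$) are elements of $\mathbb{Z}\widetilde V\subseteq\mathbb{Z}V$. $K(G)$ is $G$ plus a new sink vertex $\tilde q$ adjacent to every vertex of $V$. $\mathcal{S}$ is the set of quasi-superstable divisors: $c\in\mathbb{Z}V$ with $c+1_V$ superstable on $K(G)$, $1_V=\sum_{v\in V}v$. A $G$-parking function with respect to $v_0$ is $f:V\to\mathbb{Z}$ with $f(v_0)=-1$ and $(f(v))_{v\in\widetilde V}$ superstable on $G$, identified with the divisor $\sum_v f(v)v$. Partial orientation: $\mathcal{O}\subseteq V\times V$ with $(u,v)\in\mathcal{O}\Rightarrow\{u,v\}\in E$, $(v,u)\notin\mathcal{O}$; non-oriented edges are blank; $\mathrm{indeg}_{\mathcal{O}}(v)$, $\mathrm{outdeg}_{\mathcal{O}}(v)$ count oriented edges into / out of $v$. A potential cycle is a cycle of $G$ whose blank edges can be directed to make it directed. $\mathbb{O}$ is the set of $G$-semiorientations (partial orientations all of whose potential cycles have more blank than oriented edges). $\mathbb{O}_0=\{\mathcal{O}\in\mathbb{O}:\mathrm{outdeg}_{\mathcal{O}}(v_0)=\deg(v_0)\}$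 and $\widetilde{\mathbb{O}}_0=\{\mathcal{O}\in\mathbb{O}_0:\mathrm{indeg}_{\mathcal{O}}(v_i)\ge1\ \forall i\neq0\}$. $\psi(\mathcal{O})=\sum_{v\in V}(\mathrm{indeg}_{\mathcal{O}}(v)-1)v$. *)

theory Defs
  imports
    "Graph_Theory.Graph_Theory"
    "HOL-Library.Function_Algebras"
    "HOL-Library.Indicator_Function"
begin

text \<open>
  A finite simple undirected graph is a \<open>pair_graph\<close>: a finite loopfree symmetric digraph
  in which the edge \<open>{u, v}\<close> is the pair of arcs \<open>(u, v)\<close>, \<open>(v, u)\<close>. Hence
  \<open>out_degree\<close> is the number of edges at a vertex.

  Elements of the free abelian group on a vertex set are integer-valued functions vanishing outside
  that set, so a configuration is in particular a divisor whose sink coefficient is 0. Addition is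
  that of \<open>Function_Algebras\<close>, the order is the pointwise one, and \<open>indicator A\<close> is
  the sum of the vertices in \<open>A\<close>.
\<close>

section \<open>Sandpiles\<close>

definition divisors :: "'a pair_pre_digraph \<Rightarrow> ('a \<Rightarrow> int) set" where
  "divisors G = {c. \<forall>v. v \<notin> pverts G \<longrightarrow> c v = 0}"

definition configurations :: "'a pair_pre_digraph \<Rightarrow> 'a \<Rightarrow> ('a \<Rightarrow> int) set" where
  "configurations H s = {c. \<forall>v. v \<notin> pverts H - {s} \<longrightarrow> c v = 0}"

definition laplacian :: "'a pair_pre_digraph \<Rightarrow> 'a \<Rightarrow> 'a \<Rightarrow> int" where
  "laplacian H u v =
     (if u = v then int (out_degree (with_proj H) u) else 0) - (if (u, v) \<in> parcs H then 1 else 0)"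

definition fire :: "'a pair_pre_digraph \<Rightarrow> 'a \<Rightarrow> 'a set \<Rightarrow> ('a \<Rightarrow> int) \<Rightarrow> 'a \<Rightarrow> int" where
  "fire H s Y c =
     (\<lambda>v. if v \<in> pverts H - {s}
          then c v - (\<Sum>u \<in> pverts H - {s}. laplacian H v u * indicator Y u)
          else 0)"

definition superstable :: "'a pair_pre_digraph \<Rightarrow> 'a \<Rightarrow> ('a \<Rightarrow> int) \<Rightarrow> bool" where
  "superstable H s c \<longleftrightarrow>
     c \<in> configurations H s \<and> 0 \<le> c \<and>
     \<not> (\<exists>Y. Y \<noteq> {} \<and> Y \<subseteq> pverts H - {s} \<and> 0 \<le> fire H s Y c)"

text \<open>
  The graph \<open>K(G)\<close>: the vertex \<open>v\<close> of \<open>G\<close> becomes \<open>Some v\<close>, and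
  the new sink is \<open>None\<close>.
\<close>
definition cone :: "'a pair_pre_digraph \<Rightarrow> 'a option pair_pre_digraph" where
  "cone G =
     \<lparr> pverts = insert None (Some ` pverts G),
       parcs = map_prod Some Some ` parcs G
             \<union> {None} \<times> Some ` pverts G \<union> Some ` pverts G \<times> {None} \<rparr>"

definition quasi_superstables :: "'a pair_pre_digraph \<Rightarrow> ('a \<Rightarrow> int) set" where
  "quasi_superstables G =
     {c \<in> divisors G. superstable (cone G) None (case_option 0 (c + indicator (pverts G)))}"

definition parking_functions :: "'a pair_pre_digraph \<Rightarrow> 'a \<Rightarrow> ('a \<Rightarrow> int) set" where
  "parking_functions G v0 =
     {f \<in> divisors G. f v0 = -1 \<and> superstable G v0 (\<lambda>v. if v = v0 then 0 else f v)}"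

text \<open>The set \<open>X\<close> of vertices other than \<open>v0\<close> not adjacent to \<open>v0\<close>.\<close>
definition non_neighbours :: "'a pair_pre_digraph \<Rightarrow> 'a \<Rightarrow> 'a set" where
  "non_neighbours G v0 = {v \<in> pverts G - {v0}. (v, v0) \<notin> parcs G}"

definition sink_quasi_superstables :: "'a pair_pre_digraph \<Rightarrow> 'a \<Rightarrow> ('a \<Rightarrow> int) set" where
  "sink_quasi_superstables G v0 =
     {c \<in> quasi_superstables G.
        c v0 = -1 \<and> - indicator (non_neighbours G v0) \<le> c + indicator {v0}}"

definition nonneg_sink_quasi_superstables ::
  "'a pair_pre_digraph \<Rightarrow> 'a \<Rightarrow> ('a \<Rightarrow> int) set" where
  "nonneg_sink_quasi_superstables G v0 =
     {c \<in> quasi_superstables G. c v0 = -1 \<and> 0 \<le> c + indicator {v0}}"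

text \<open>The graph \<open>K(G)\<^sub>0\<close>.\<close>
definition join_sink :: "'a pair_pre_digraph \<Rightarrow> 'a \<Rightarrow> 'a pair_pre_digraph" where
  "join_sink G v0 =
     \<lparr> pverts = pverts G,
       parcs = parcs G \<union> non_neighbours G v0 \<times> {v0} \<union> {v0} \<times> non_neighbours G v0 \<rparr>"


section \<open>Semiorientations\<close>

definition partial_orientation :: "'a pair_pre_digraph \<Rightarrow> 'a rel \<Rightarrow> bool" where
  "partial_orientation G \<O> \<longleftrightarrow>
     \<O> \<subseteq> pverts G \<times> pverts G \<and> (\<forall>u v. (u, v) \<in> \<O> \<longrightarrow> (u, v) \<in> parcs G \<and> (v, u) \<notin> \<O>)"

definition indeg :: "'a rel \<Rightarrow> 'a \<Rightarrow> nat" where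
  "indeg \<O> v = card {u. (u, v) \<in> \<O>}"

definition outdeg :: "'a rel \<Rightarrow> 'a \<Rightarrow> nat" where
  "outdeg \<O> v = card {u. (v, u) \<in> \<O>}"

text \<open>
  Cycles of an undirected graph are given by their closed traversals, as arc lists. The library
  counts \<open>[(u, v), (v, u)]\<close> as a cycle; the bound on the length excludes it. Each edge of
  such a cycle is traversed exactly once, so sets of arcs of \<open>p\<close> count edges.
\<close>
definition undirected_cycle :: "'a pair_pre_digraph \<Rightarrow> ('a \<times> 'a) list \<Rightarrow> bool" where
  "undirected_cycle G p \<longleftrightarrow> pre_digraph.cycle (with_proj G) p \<and> 3 \<le> length p"

text \<open>
  The cycle can be completed to a directed one, in the direction of traversal \<open>p\<close>. (The
  opposite direction is that of another traversal.)
\<close>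
definition potential_cycle :: "'a pair_pre_digraph \<Rightarrow> 'a rel \<Rightarrow> ('a \<times> 'a) list \<Rightarrow> bool" where
  "potential_cycle G \<O> p \<longleftrightarrow>
     undirected_cycle G p \<and>
     (\<exists>\<O>'. partial_orientation G \<O>' \<and> \<O> \<subseteq> \<O>' \<and> set p \<subseteq> \<O>')"

definition oriented_edges :: "'a rel \<Rightarrow> ('a \<times> 'a) list \<Rightarrow> ('a \<times> 'a) set" where
  "oriented_edges \<O> p = {(u, v) \<in> set p. (u, v) \<in> \<O> \<or> (v, u) \<in> \<O>}"

definition blank_edges :: "'a rel \<Rightarrow> ('a \<times> 'a) list \<Rightarrow> ('a \<times> 'a) set" where
  "blank_edges \<O> p = {(u, v) \<in> set p. (u, v) \<notin> \<O> \<and> (v, u) \<notin> \<O>}"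

definition semiorientations :: "'a pair_pre_digraph \<Rightarrow> 'a rel set" where
  "semiorientations G =
     {\<O>. partial_orientation G \<O> \<and>
         (\<forall>p. potential_cycle G \<O> p \<longrightarrow> card (oriented_edges \<O> p) < card (blank_edges \<O> p))}"

definition sourced_semiorientations :: "'a pair_pre_digraph \<Rightarrow> 'a \<Rightarrow> 'a rel set" where
  "sourced_semiorientations G v0 =
     {\<O> \<in> semiorientations G. outdeg \<O> v0 = out_degree (with_proj G) v0}"

definition uniquely_sourced_semiorientations :: "'a pair_pre_digraph \<Rightarrow> 'a \<Rightarrow> 'a rel set" where
  "uniquely_sourced_semiorientations G v0 =
     {\<O> \<in> sourced_semiorientations G v0. \<forall>v \<in> pverts G - {v0}. 1 \<le> indeg \<O> v}"

definition indeg_divisor :: "'a pair_pre_digraph \<Rightarrow> 'a rel \<Rightarrow> 'a \<Rightarrow> int" where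
  "indeg_divisor G \<O> = (\<lambda>v. if v \<in> pverts G then int (indeg \<O> v) - 1 else 0)"

end

theory Submission
  imports Defs
begin

text \<open>
  Each of the superstability conditions says that \<open>c\<close> is bounded below and that every nonempty
  \<open>Y\<close> contains a vertex \<open>v\<close> with \<open>c v\<close> smaller than the number of edges of \<open>G\<close> from \<open>v\<close> to
  the complement of \<open>Y\<close>: the shift by \<open>1\<^sub>X\<close> or \<open>1\<^sub>V\<close> cancels against the added edges to the sink,
  and sets containing \<open>v\<^sub>0\<close> are harmless since \<open>c v\<^sub>0 = -1\<close>.

  A semiorientation is acyclic, so every such \<open>Y\<close> contains a vertex without incoming edges from \<open>Y\<close>,
  which yields the condition for the indegree divisor. Conversely, given \<open>c\<close>, the vertices are
  burnt at distinct times \<open>x v\<close>, starting from \<open>v\<^sub>0\<close>, such that exactly \<open>c v + 1\<close> neighbours of \<open>v\<close>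
  burn more than one time unit before \<open>v\<close>. Orienting \<open>u \<rightarrow> v\<close> if and only if \<open>x u + 1 < x v\<close> gives a
  semiorientation, because along a potential cycle \<open>x\<close> rises by more than 1 on oriented
  edges and drops by at most 1 on blank ones.
\<close>

section \<open>Superstability\<close>

text \<open>Dhar's criterion: firing \<open>Y\<close> costs each \<open>v\<close> in
  \<open>Y\<close> one unit per edge leaving \<open>Y\<close>, and some vertex of \<open>Y\<close>
  cannot pay. No lower bound on \<open>c\<close> is built in, so \<open>c\<close> may be negative at
  a vertex of \<open>W\<close>.\<close>

definition unfirable :: "'a rel \<Rightarrow> 'a set \<Rightarrow> ('a \<Rightarrow> int) \<Rightarrow> bool" where
  "unfirable E W c \<longleftrightarrow>
     (\<forall>Y. Y \<subseteq> W \<longrightarrow> Y \<noteq> {} \<longrightarrow> (\<exists>v\<in>Y. c v < int (card (E `` {v} - Y))))"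

lemma unfirable_cong:
  assumes "\<And>v. v \<in> W \<Longrightarrow> c v = d v"
  shows "unfirable E W c \<longleftrightarrow> unfirable E W d"
  unfolding unfirable_def using assms by (metis subsetD)

lemma unfirable_remove:
  assumes "c s < 0"
  shows "unfirable E W c \<longleftrightarrow> unfirable E (W - {s}) c"
proof
  assume "unfirable E (W - {s}) c"
  show "unfirable E W c"
    unfolding unfirable_def
  proof (intro allI impI)
    fix Y assume Y: "Y \<subseteq> W" "Y \<noteq> {}"
    show "\<exists>v\<in>Y. c v < int (card (E `` {v} - Y))"
    proof (cases "s \<in> Y")
      case True
      have "c s < int (card (E `` {s} - Y))" using assms by linarith
      with True show ?thesis by blast
    next
      case False
      with Y have "Y \<subseteq> W - {s}" by blast
      with Y \<open>unfirable E (W - {s}) c\<close> show ?thesis unfolding unfirable_def by blast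
    qed
  qed
qed (auto simp: unfirable_def)

lemma out_degree_with_proj: "out_degree (with_proj H) v = card (parcs H `` {v})"
proof -
  have "out_arcs (with_proj H) v = Pair v ` (parcs H `` {v})"
    by (auto simp: out_arcs_def)
  then show ?thesis
    by (simp add: out_degree_def card_image inj_on_def)
qed

text \<open>Over the columns in \<open>Y\<close>, the Laplacian row of \<open>v\<close> sums to its
  degree, if \<open>v\<close> lies in \<open>Y\<close>, minus its number of neighbours in
  \<open>Y\<close>; for \<open>v\<close> in \<open>Y\<close> this counts the edges leaving
  \<open>Y\<close>.\<close>

lemma fire_eq:
  assumes fin: "finite (pverts H)" and arcs: "parcs H \<subseteq> pverts H \<times> pverts H"
    and Y: "Y \<subseteq> pverts H - {s}" and v: "v \<in> pverts H - {s}"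
  shows "fire H s Y c v =
    (if v \<in> Y then c v - int (card (parcs H `` {v} - Y)) else c v + int (card (parcs H `` {v} \<inter> Y)))"
proof -
  let ?N = "parcs H `` {v}"
  have finY: "finite Y" using Y fin by (meson finite_Diff finite_subset)
  have "?N \<subseteq> pverts H" using arcs by auto
  then have finN: "finite ?N" using fin by (rule finite_subset)
  have "(\<Sum>u\<in>pverts H - {s}. laplacian H v u * indicator Y u) = (\<Sum>u\<in>Y. laplacian H v u)"
    using Y fin by (intro sum.mono_neutral_cong_right) (auto simp: indicator_def)
  also have "\<dots> = (\<Sum>u\<in>Y. if v = u then int (card ?N) else 0)
      - (\<Sum>u\<in>Y. if (v, u) \<in> parcs H then 1 else 0)"
    by (simp add: laplacian_def sum_subtractf out_degree_with_proj cong: if_cong)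
  also have "(\<Sum>u\<in>Y. if (v, u) \<in> parcs H then 1 else 0) = int (card (?N \<inter> Y))"
  proof -
    have "{u \<in> Y. (v, u) \<in> parcs H} = ?N \<inter> Y" by auto
    then show ?thesis using finY by (simp add: sum.If_cases Int_def conj_commute)
  qed
  also have "(\<Sum>u\<in>Y. if v = u then int (card ?N) else 0) = (if v \<in> Y then int (card ?N) else 0)"
    using finY by simp
  finally have "fire H s Y c v =
      c v - ((if v \<in> Y then int (card ?N) else 0) - int (card (?N \<inter> Y)))"
    using v by (simp add: fire_def)
  moreover have "card ?N = card (?N \<inter> Y) + card (?N - Y)"
    using finN by (metis card_Int_Diff)
  ultimately show ?thesis by auto
qed

text \<open>Firing \<open>Y\<close> never lowers a value outside \<open>Y\<close>, so for
  nonnegative \<open>c\<close> only a vertex of \<open>Y\<close> can block it.\<close>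

lemma superstable_iff_unfirable:
  assumes fin: "finite (pverts H)" and arcs: "parcs H \<subseteq> pverts H \<times> pverts H"
  shows "superstable H s c \<longleftrightarrow>
    c \<in> configurations H s \<and> 0 \<le> c \<and> unfirable (parcs H) (pverts H - {s}) c"
proof -
  have fire_nonneg_iff: "0 \<le> fire H s Y c \<longleftrightarrow> (\<forall>v\<in>Y. \<not> c v < int (card (parcs H `` {v} - Y)))"
    if c: "0 \<le> c" and Y: "Y \<subseteq> pverts H - {s}" for Y
  proof
    assume L: "0 \<le> fire H s Y c"
    show "\<forall>v\<in>Y. \<not> c v < int (card (parcs H `` {v} - Y))"
    proof
      fix v assume v: "v \<in> Y"
      with Y have "v \<in> pverts H - {s}" by blast
      from fire_eq[OF fin arcs Y this, of c] v
      have "fire H s Y c v = c v - int (card (parcs H `` {v} - Y))" by simp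
      moreover from L have "0 \<le> fire H s Y c v" by (simp add: le_fun_def)
      ultimately show "\<not> c v < int (card (parcs H `` {v} - Y))" by simp
    qed
  next
    assume R: "\<forall>v\<in>Y. \<not> c v < int (card (parcs H `` {v} - Y))"
    have "0 \<le> fire H s Y c v" for v
    proof (cases "v \<in> pverts H - {s}")
      case True
      have "0 \<le> c v" using c by (simp add: le_fun_def)
      with fire_eq[OF fin arcs Y True, of c] R show ?thesis by (auto simp: not_less)
    next
      case False
      then show ?thesis by (simp only: fire_def if_False)
    qed
    then show "0 \<le> fire H s Y c" by (simp add: le_fun_def)
  qed
  have "(\<nexists>Y. Y \<noteq> {} \<and> Y \<subseteq> pverts H - {s} \<and> 0 \<le> fire H s Y c) \<longleftrightarrow>
      unfirable (parcs H) (pverts H - {s}) c" if "0 \<le> c"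
  proof -
    have "(\<nexists>Y. Y \<noteq> {} \<and> Y \<subseteq> pverts H - {s} \<and> 0 \<le> fire H s Y c) \<longleftrightarrow>
        (\<forall>Y. Y \<subseteq> pverts H - {s} \<longrightarrow> Y \<noteq> {} \<longrightarrow> \<not> 0 \<le> fire H s Y c)"
      by blast
    also have "\<dots> \<longleftrightarrow> unfirable (parcs H) (pverts H - {s}) c"
      unfolding unfirable_def
      by (intro all_cong1 imp_cong refl) (simp add: fire_nonneg_iff[OF that])
    finally show ?thesis .
  qed
  then show ?thesis
    unfolding superstable_def by (intro conj_cong refl)
qed

section \<open>Burning times\<close>

text \<open>Supplies the next current time: after \<open>t\<close>, but before any later arrival in
  \<open>A\<close> and before the signal of a vertex burnt at \<open>t\<close>.\<close>

lemma finite_gap_above: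
  fixes A :: "real set"
  assumes "finite A"
  obtains t' where "t < t'" "t' < t + 1" "\<And>a. a \<in> A \<Longrightarrow> t < a \<Longrightarrow> t' < a"
proof -
  \<comment> \<open>Inserting \<open>t + 1\<close> keeps the minimum defined and at most
    \<open>t + 1\<close>; the midpoint of \<open>t\<close> and \<open>m\<close> then makes all
    inequalities strict.\<close>
  define m where "m = Min (insert (t + 1) {a \<in> A. t < a})"
  have fin: "finite (insert (t + 1) {a \<in> A. t < a})" using assms by simp
  have "t < m" unfolding m_def using fin by (subst Min_gr_iff) auto
  moreover have "m \<le> a" if "a = t + 1 \<or> a \<in> A \<and> t < a" for a
    unfolding m_def using fin that by (intro Min_le) auto
  ultimately show ?thesis by (intro that[of "(t + m) / 2"]) force+
qed

text \<open>
  A burnt vertex \<open>u\<close> sends a signal to its neighbours one time unit after its burning time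
  \<open>x u\<close>, and \<open>v\<close> burns once \<open>f v\<close> signals have reached it. Here \<open>B\<close> is the set of vertices
  burnt before the current time \<open>T\<close>. In each step either some vertex burns at \<open>T\<close>, or
  \<open>T\<close> moves just beyond the next arrival of a signal. As burning times are distinct, no
  vertex receives two signals at once.
\<close>
lemma burning_times_extend:
  fixes N :: "'a \<Rightarrow> 'a set" and f :: "'a \<Rightarrow> nat" and x :: "'a \<Rightarrow> real"
  assumes fin: "finite V"
    and N: "\<And>v. v \<in> V \<Longrightarrow> N v \<subseteq> V - {v}"
    and dhar: "\<And>Y. Y \<subseteq> V \<Longrightarrow> Y \<noteq> {} \<Longrightarrow> \<exists>v\<in>Y. f v \<le> card (N v - Y)"
    and "B \<subseteq> V" "inj_on x B"
    and "\<And>u. u \<in> B \<Longrightarrow> x u < T" "\<And>u. u \<in> B \<Longrightarrow> x u + 1 \<noteq> T"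
    and "\<And>v. v \<in> B \<Longrightarrow> card {u \<in> N v \<inter> B. x u + 1 < x v} = f v"
    and "\<And>v. v \<in> V - B \<Longrightarrow> card {u \<in> N v \<inter> B. x u + 1 < T} \<le> f v"
  shows "\<exists>y. (\<forall>u\<in>B. y u = x u) \<and> (\<forall>v\<in>V - B. T \<le> y v) \<and>
    (\<forall>v\<in>V. card {u \<in> N v. y u + 1 < y v} = f v)"
  using assms(4-)
\<comment> \<open>The second summand counts signals under way. Burning a vertex lowers the first
  summand by 2 and adds at most one signal; waiting lets one signal arrive.\<close>
proof (induction "2 * card (V - B) + card {u \<in> B. T < x u + 1}" arbitrary: B x T rule: less_induct)
  case less
  note B = less.prems(1) and inj = less.prems(2) and before = less.prems(3)
    and no_tie = less.prems(4) and burnt = less.prems(5) and unburnt = less.prems(6)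
  have finB: "finite B" using B fin by (rule finite_subset)
  consider (all) "B = V"
    | (burn) w where "w \<in> V - B" "card {u \<in> N w \<inter> B. x u + 1 < T} = f w"
    | (wait) "B \<noteq> V" "\<forall>w\<in>V - B. card {u \<in> N w \<inter> B. x u + 1 < T} < f w"
    using unburnt le_neq_implies_less by blast
  then show ?case
  proof cases
    case all
    have "card {u \<in> N v. x u + 1 < x v} = f v" if "v \<in> V" for v
    proof -
      have "{u \<in> N v \<inter> B. x u + 1 < x v} = {u \<in> N v. x u + 1 < x v}"
        using N[OF that] all by auto
      with burnt that all show ?thesis by metis
    qed
    with all show ?thesis by auto
  next
    case burn
    obtain T' where T': "T < T'" "T' < T + 1" "\<And>a. a \<in> (\<lambda>u. x u + 1) ` B \<Longrightarrow> T < a \<Longrightarrow> T' < a"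
      using finite_gap_above[of "(\<lambda>u. x u + 1) ` B" T] finB by blast
    define x' where "x' = x(w := T)"
    have x'_B: "x' u = x u" if "u \<in> B" for u
      using that burn(1) by (auto simp: x'_def)
    have x'_w: "x' w = T" by (simp add: x'_def)
    \<comment> \<open>No signal arrives at \<open>T\<close> or from then up to \<open>T'\<close>, so
      those received by \<open>T'\<close> are those received by \<open>T\<close>.\<close>
    have arrived: "x u + 1 < T' \<longleftrightarrow> x u + 1 < T" if "u \<in> B" for u
      using T'(1) T'(3)[of "x u + 1"] no_tie[OF that] that by force
    have "\<exists>y. (\<forall>u\<in>insert w B. y u = x' u) \<and> (\<forall>v\<in>V - insert w B. T' \<le> y v) \<and>
      (\<forall>v\<in>V. card {u \<in> N v. y u + 1 < y v} = f v)"
    proof (rule less.hyps)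
      have "card (V - B) = Suc (card (V - insert w B))"
        using burn(1) fin by (metis Diff_insert card_Suc_Diff1 finite_Diff)
      moreover have "{u \<in> insert w B. T' < x' u + 1} \<subseteq> insert w {u \<in> B. T < x u + 1}"
        using T'(1) x'_B by force
      then have "card {u \<in> insert w B. T' < x' u + 1} \<le> card (insert w {u \<in> B. T < x u + 1})"
        using finB by (intro card_mono) auto
      then have "card {u \<in> insert w B. T' < x' u + 1} \<le> Suc (card {u \<in> B. T < x u + 1})"
        using finB by (simp add: card_insert_if split: if_splits)
      ultimately show "2 * card (V - insert w B) + card {u \<in> insert w B. T' < x' u + 1} <
          2 * card (V - B) + card {u \<in> B. T < x u + 1}"
        by linarith
      show "insert w B \<subseteq> V" using burn(1) B by blast
      show "inj_on x' (insert w B)"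
        unfolding inj_on_insert
      proof
        show "inj_on x' B" using inj x'_B by (simp add: inj_on_def)
        show "x' w \<notin> x' ` (B - {w})" using before x'_B x'_w by fastforce
      qed
      show "x' u < T'" if "u \<in> insert w B" for u
        using that x'_B x'_w before T'(1) by force
      show "x' u + 1 \<noteq> T'" if "u \<in> insert w B" for u
      proof (cases "u = w")
        case True
        then show ?thesis using x'_w T'(2) by simp
      next
        case False
        with that have "u \<in> B" by simp
        with x'_B[OF this] T'(1) T'(3)[of "x u + 1"] no_tie[OF this] show ?thesis by force
      qed
      \<comment> \<open>The signal of \<open>w\<close> arrives only at \<open>T + 1\<close>, too
        late to count for any vertex burnt by \<open>T\<close>; \<open>w\<close> itself has received
        exactly \<open>f w\<close>.\<close>
      show "card {u \<in> N v \<inter> insert w B. x' u + 1 < x' v} = f v" if "v \<in> insert w B" for v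
      proof (cases "v = w")
        case True
        have "{u \<in> N v \<inter> insert w B. x' u + 1 < x' v} = {u \<in> N w \<inter> B. x u + 1 < T}"
          using True x'_B x'_w N[of w] burn(1) by auto
        with burn(2) True show ?thesis by simp
      next
        case False
        with that have v: "v \<in> B" by simp
        have "{u \<in> N v \<inter> insert w B. x' u + 1 < x' v} = {u \<in> N v \<inter> B. x u + 1 < x v}"
          using x'_B x'_w before[OF v] v by auto
        with burnt[OF v] show ?thesis by simp
      qed
      show "card {u \<in> N v \<inter> insert w B. x' u + 1 < T'} \<le> f v" if "v \<in> V - insert w B" for v
      proof -
        have "{u \<in> N v \<inter> insert w B. x' u + 1 < T'} = {u \<in> N v \<inter> B. x u + 1 < T}"
          using x'_B x'_w T'(2) arrived by auto
        with unburnt that show ?thesis by simp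
      qed
    qed
    then obtain y where y: "\<forall>u\<in>insert w B. y u = x' u" "\<forall>v\<in>V - insert w B. T' \<le> y v"
      "\<forall>v\<in>V. card {u \<in> N v. y u + 1 < y v} = f v"
      by blast
    have "\<forall>u\<in>B. y u = x u" using y(1) x'_B by simp
    moreover have "\<forall>v\<in>V - B. T \<le> y v"
    proof
      fix v assume "v \<in> V - B"
      then show "T \<le> y v" using y(1,2) x'_w T'(1) by (cases "v = w") force+
    qed
    ultimately show ?thesis using y(3) by blast
  next
    case wait
    define P where "P = {u \<in> B. T < x u + 1}"
    \<comment> \<open>Were no signal under way, every burnt neighbour would have signalled, and the
      vertex that \<open>dhar\<close> finds in \<open>V - B\<close> would have its
      \<open>f v\<close> signals, contrary to \<open>wait\<close>.\<close>
    have "P \<noteq> {}"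
    proof
      assume "P = {}"
      obtain v where v: "v \<in> V - B" "f v \<le> card (N v - (V - B))"
        using dhar[of "V - B"] wait(1) B by blast
      have "N v - (V - B) = {u \<in> N v \<inter> B. x u + 1 < T}"
        using N[of v] v(1) B \<open>P = {}\<close> no_tie by (force simp: P_def)
      with v wait(2) show False by (metis leD)
    qed
    have finP: "finite P" using finB by (simp add: P_def)
    obtain a where a: "a \<in> P" "\<And>u. u \<in> P \<Longrightarrow> x a \<le> x u"
      using ex_min_if_finite[of "x ` P"] \<open>P \<noteq> {}\<close> finP
      by (metis (no_types, lifting) arg_min_if_finite(1) arg_min_least)
    have aB: "a \<in> B" "T < x a + 1" using a(1) by (auto simp: P_def)
    obtain T' where T': "x a + 1 < T'"
      "\<And>b. b \<in> (\<lambda>u. x u + 1) ` B \<Longrightarrow> x a + 1 < b \<Longrightarrow> T' < b"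
      using finite_gap_above[of "(\<lambda>u. x u + 1) ` B" "x a + 1"] finB by blast
    \<comment> \<open>Distinct burning times make \<open>a\<close> the only vertex of
      \<open>P\<close> whose signal arrives by \<open>T'\<close>.\<close>
    have late: "T' < x u + 1" if "u \<in> P" "u \<noteq> a" for u
    proof -
      have "u \<in> B" using that by (simp add: P_def)
      then have "x u \<noteq> x a" using inj aB(1) that(2) by (auto simp: inj_on_def)
      with a(2)[OF that(1)] T'(2)[of "x u + 1"] \<open>u \<in> B\<close> show ?thesis by auto
    qed
    have early: "x u + 1 < T" if "u \<in> B" "u \<notin> P" for u
      using that no_tie[of u] by (auto simp: P_def)
    have "\<exists>y. (\<forall>u\<in>B. y u = x u) \<and> (\<forall>v\<in>V - B. T' \<le> y v) \<and>
      (\<forall>v\<in>V. card {u \<in> N v. y u + 1 < y v} = f v)"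
    proof (rule less.hyps)
      have "{u \<in> B. T' < x u + 1} \<subset> P"
      proof
        show "{u \<in> B. T' < x u + 1} \<subseteq> P" using aB(2) T'(1) by (auto simp: P_def)
        show "{u \<in> B. T' < x u + 1} \<noteq> P" using a(1) T'(1) by force
      qed
      then have "card {u \<in> B. T' < x u + 1} < card P" using finP by (simp add: psubset_card_mono)
      then show "2 * card (V - B) + card {u \<in> B. T' < x u + 1} <
          2 * card (V - B) + card {u \<in> B. T < x u + 1}"
        by (simp add: P_def)
      show "B \<subseteq> V" "inj_on x B" by fact+
      show "x u < T'" if "u \<in> B" for u using before[OF that] aB(2) T'(1) by linarith
      show "x u + 1 \<noteq> T'" if "u \<in> B" for u
        using early[OF that] late[of u] T'(1) aB(2) by (cases "u \<in> P"; cases "u = a") force+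
      show "card {u \<in> N v \<inter> B. x u + 1 < x v} = f v" if "v \<in> B" for v
        using burnt[OF that] .
      \<comment> \<open>Passing to \<open>T'\<close> adds at most the signal of \<open>a\<close>,
        and by \<open>wait\<close> every unburnt vertex was short by at least one.\<close>
      show "card {u \<in> N v \<inter> B. x u + 1 < T'} \<le> f v" if v: "v \<in> V - B" for v
      proof -
        have "{u \<in> N v \<inter> B. x u + 1 < T'} \<subseteq> insert a {u \<in> N v \<inter> B. x u + 1 < T}"
          using early late by (force simp: not_less)
        then have "card {u \<in> N v \<inter> B. x u + 1 < T'} \<le> card (insert a {u \<in> N v \<inter> B. x u + 1 < T})"
          using finB by (intro card_mono) auto
        also have "\<dots> \<le> Suc (card {u \<in> N v \<inter> B. x u + 1 < T})"
          using finB by (simp add: card_insert_if)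
        also have "\<dots> \<le> f v" using wait(2) v by (simp add: Suc_le_eq)
        finally show ?thesis .
      qed
    qed
    then show ?thesis using T'(1) aB(2) by (meson less_le_trans less_imp_le less_trans)
  qed
qed

lemma burning_times:
  fixes N :: "'a \<Rightarrow> 'a set" and f :: "'a \<Rightarrow> nat"
  assumes "finite V"
    and N: "\<And>v. v \<in> V \<Longrightarrow> N v \<subseteq> V - {v}"
    and "\<And>Y. Y \<subseteq> V \<Longrightarrow> Y \<noteq> {} \<Longrightarrow> \<exists>v\<in>Y. f v \<le> card (N v - Y)"
    and "s \<in> V" "f s = 0"
  obtains x :: "'a \<Rightarrow> real" where "\<And>v. v \<in> V \<Longrightarrow> x s \<le> x v"
    and "\<And>v. v \<in> V \<Longrightarrow> card {u \<in> N v. x u + 1 < x v} = f v"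
proof -
  \<comment> \<open>With \<open>s\<close> burnt at 0, time 1/2 precedes the arrival of its signal at
    1, so all counts start at 0, as \<open>f s = 0\<close> demands.\<close>
  have "\<exists>y::'a \<Rightarrow> real. (\<forall>u\<in>{s}. y u = 0) \<and> (\<forall>v\<in>V - {s}. 1/2 \<le> y v) \<and>
    (\<forall>v\<in>V. card {u \<in> N v. y u + 1 < y v} = f v)"
    using assms by (intro burning_times_extend) auto
  then obtain y :: "'a \<Rightarrow> real" where y: "y s = 0" "\<forall>v\<in>V - {s}. 1/2 \<le> y v"
    "\<forall>v\<in>V. card {u \<in> N v. y u + 1 < y v} = f v"
    by auto
  show ?thesis
  proof (rule that)
    show "y s \<le> y v" if "v \<in> V" for v using y(1,2) that by (cases "v = s") force+
  qed (use y(3) in blast)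
qed


section \<open>Semiorientations and quasi-superstable divisors\<close>

text \<open>The sum telescopes; around a closed walk it is 0.\<close>

lemma sum_list_pcas: "pcas u p v \<Longrightarrow> (\<Sum>e\<leftarrow>p. x (snd e) - x (fst e)) = (x v - x u :: real)"
  by (induction p arbitrary: u) auto

lemma Collect_diff_cong:
  fixes a :: "'b :: minus"
  assumes "\<And>c. c \<in> A \<Longrightarrow> P c \<longleftrightarrow> Q c"
  shows "{c - a | c. c \<in> A \<and> P c} = {c - a | c. c \<in> A \<and> Q c}"
  by (intro Collect_cong ex_cong1 conj_cong refl) (simp add: assms)

context pair_graph
begin

lemma finite_neighbours: "finite (parcs G `` {v})"
proof -
  have "parcs G `` {v} \<subseteq> snd ` parcs G" by force
  then show ?thesis using pair_finite_arcs by (simp add: finite_subset)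
qed

lemma arcs_sym: "(u, v) \<in> parcs G \<longleftrightarrow> (v, u) \<in> parcs G"
  using pair_sym_arcs by (auto simp: symmetric_def sym_def)

lemma arcs_subset: "parcs G \<subseteq> pverts G \<times> pverts G"
  using wellformed' by auto

lemma neighbours_subset: "parcs G `` {v} \<subseteq> pverts G - {v}"
  using wellformed' pair_no_loops by force

section \<open>Indegree divisors of semiorientations\<close>

text \<open>A directed cycle would be a potential cycle without blank edges, its completion being
  \<open>\<O>\<close> itself.\<close>

lemma acyclic_semiorientation:
  assumes "\<O> \<in> semiorientations G"
  shows "acyclic \<O>"
proof (rule acyclicI, intro allI notI)
  fix a assume a: "(a, a) \<in> \<O>\<^sup>+"
  \<comment> \<open>With the oriented arcs as a digraph of their own, a closed walk shortens to a
    cycle that still uses only arcs of \<open>\<O>\<close>.\<close>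
  define H where "H = \<lparr>pverts = pverts G, parcs = \<O>\<rparr>"
  then have H: "pverts H = pverts G" "parcs H = \<O>" by simp_all
  have po: "partial_orientation G \<O>" using assms by (simp add: semiorientations_def)
  interpret H: pair_wf_digraph H
    using po by unfold_locales (auto simp: H partial_orientation_def)
  have "a \<rightarrow>\<^sup>+\<^bsub>with_proj H\<^esub> a" using a by (simp add: H)
  then obtain p where "H.awalk a p a" "p \<noteq> []"
    using H.reachable1_awalk[of a a] by auto
  then have "H.closed_w p" by (auto simp: H.closed_w_def)
  then obtain q where q: "H.cycle q" using H.closed_w_imp_cycle by blast
  then obtain u where u: "H.awalk u q u" "distinct (tl (pawalk_verts u q))" "q \<noteq> []"
    by (auto simp: H.cycle_def)
  have sub: "set q \<subseteq> \<O>" using u(1) by (auto simp: H.awalk_def H)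
  have "awalk u q u"
    using u(1) po by (auto simp: H.awalk_def awalk_def H partial_orientation_def)
  then have "cycle q" using u by (auto simp: cycle_def)
  have cas: "pcas u q u" using u(1) by (simp add: H.awalk_def)
  have antisym: "(w, v) \<notin> \<O>" if "(v, w) \<in> \<O>" for v w
    using po that by (auto simp: partial_orientation_def)
  \<comment> \<open>A traversal of length 1 or 2 would contain a loop or both directions of one
    edge, which \<open>antisym\<close> excludes.\<close>
  have "3 \<le> length q"
  proof (rule ccontr)
    assume "\<not> 3 \<le> length q"
    moreover have "length q \<noteq> 0" using u(3) by simp
    ultimately have "length q = 1 \<or> length q = 2" by arith
    then show False
    proof
      assume "length q = 1"
      then obtain e where "q = [e]" by (auto simp: length_Suc_conv)
      then show False using cas sub antisym by (cases e) auto
    next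
      assume "length q = 2"
      then obtain e e' where "q = [e, e']" by (auto simp: length_Suc_conv numeral_2_eq_2)
      then show False using cas sub antisym by (cases e; cases e') auto
    qed
  qed
  with \<open>cycle q\<close> have "undirected_cycle G q" by (simp add: undirected_cycle_def)
  with po sub have "potential_cycle G \<O> q" unfolding potential_cycle_def by blast
  moreover have "blank_edges \<O> q = {}" using sub by (auto simp: blank_edges_def)
  ultimately show False using assms by (auto simp: semiorientations_def)
qed

lemma indeg_le_degree:
  assumes "partial_orientation G \<O>" "\<And>u. u \<in> Y \<Longrightarrow> (u, v) \<notin> \<O>"
  shows "indeg \<O> v \<le> card (parcs G `` {v} - Y)"
  unfolding indeg_def using assms arcs_sym finite_neighbours
  by (intro card_mono) (auto simp: partial_orientation_def)

lemma unfirable_indeg_divisor: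
  assumes O: "\<O> \<in> semiorientations G"
  shows "unfirable (parcs G) (pverts G) (indeg_divisor G \<O>)"
  unfolding unfirable_def
proof (intro allI impI)
  fix Y assume Y: "Y \<subseteq> pverts G" "Y \<noteq> {}"
  have po: "partial_orientation G \<O>" using O by (simp add: semiorientations_def)
  then have "\<O> \<subseteq> parcs G" by (auto simp: partial_orientation_def)
  then have "finite \<O>" using pair_finite_arcs by (rule finite_subset)
  then have "wf \<O>" using acyclic_semiorientation[OF O] by (rule finite_acyclic_wf)
  \<comment> \<open>A minimal vertex of \<open>Y\<close> gets all its incoming edges from outside
    \<open>Y\<close>; the 1 subtracted in \<open>indeg_divisor\<close> makes the resulting bound
    strict.\<close>
  then obtain v where v: "v \<in> Y" "\<And>u. (u, v) \<in> \<O> \<Longrightarrow> u \<notin> Y"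
    using Y(2) by (metis wf_eq_minimal ex_in_conv)
  have "indeg \<O> v \<le> card (parcs G `` {v} - Y)" using po v(2) by (intro indeg_le_degree) auto
  then show "\<exists>v\<in>Y. indeg_divisor G \<O> v < int (card (parcs G `` {v} - Y))"
    using v(1) Y(1) by (intro bexI[of _ v]) (auto simp: indeg_divisor_def)
qed

section \<open>Semiorientations from burning times\<close>

lemma threshold_semiorientation:
  fixes x :: "'a \<Rightarrow> real"
  defines "\<O> \<equiv> {(u, v) \<in> parcs G. x u + 1 < x v}"
  shows "\<O> \<in> semiorientations G"
proof -
  have po: "partial_orientation G \<O>"
    using wellformed' by (auto simp: partial_orientation_def \<O>_def)
  have "card (oriented_edges \<O> p) < card (blank_edges \<O> p)" if p: "potential_cycle G \<O> p" for p
  proof -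
    let ?A = "oriented_edges \<O> p" and ?B = "blank_edges \<O> p"
    obtain \<O>' where \<O>': "partial_orientation G \<O>'" "\<O> \<subseteq> \<O>'" "set p \<subseteq> \<O>'"
      using p by (auto simp: potential_cycle_def)
    have cyc: "cycle p" and len: "3 \<le> length p"
      using p by (auto simp: potential_cycle_def undirected_cycle_def)
    then obtain u where u: "awalk u p u" "distinct p" by (auto simp: cycle_conv)
    have arcs: "set p \<subseteq> parcs G" and cas: "pcas u p u" using u(1) by (auto simp: awalk_def)
    have split: "set p = ?A \<union> ?B" "?A \<inter> ?B = {}"
      by (auto simp: oriented_edges_def blank_edges_def)
    have fin: "finite ?A" "finite ?B" using split(1) by (metis finite_Un finite_set)+
    have card: "card ?A + card ?B = length p"
      using split fin u(2) by (metis card_Un_disjoint distinct_card)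
    \<comment> \<open>The completion contains \<open>p\<close> and \<open>\<O>\<close> but never
      both directions of an edge, so oriented edges of \<open>p\<close> point along the
      traversal.\<close>
    have up: "1 < x (snd e) - x (fst e)" if e: "e \<in> ?A" for e
    proof -
      obtain a b where ab: "e = (a, b)" "(a, b) \<in> set p" "(a, b) \<in> \<O> \<or> (b, a) \<in> \<O>"
        using e by (auto simp: oriented_edges_def)
      with \<O>' have "(a, b) \<in> \<O>" unfolding partial_orientation_def by blast
      with ab(1) show ?thesis by (simp add: \<O>_def)
    qed
    have down: "- 1 \<le> x (snd e) - x (fst e)" if e: "e \<in> ?B" for e
    proof -
      obtain a b where ab: "e = (a, b)" "(a, b) \<in> set p" "(b, a) \<notin> \<O>"
        using e by (auto simp: blank_edges_def)
      with arcs arcs_sym have "(b, a) \<in> parcs G" by blast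
      with ab show ?thesis by (auto simp: \<O>_def)
    qed
    have "0 = (\<Sum>e\<leftarrow>p. x (snd e) - x (fst e))" using sum_list_pcas[OF cas] by simp
    also have "\<dots> = (\<Sum>e\<in>?A. x (snd e) - x (fst e)) + (\<Sum>e\<in>?B. x (snd e) - x (fst e))"
      using split fin u(2) by (simp add: sum_list_distinct_conv_sum_set sum.union_disjoint)
    finally have total: "(\<Sum>e\<in>?A. x (snd e) - x (fst e)) + (\<Sum>e\<in>?B. x (snd e) - x (fst e)) = 0"
      by simp
    have "- real (card ?B) \<le> (\<Sum>e\<in>?B. x (snd e) - x (fst e))"
      using sum_bounded_below[of ?B "- 1" "\<lambda>e. x (snd e) - x (fst e)"] down by simp
    with total have le: "(\<Sum>e\<in>?A. x (snd e) - x (fst e)) \<le> real (card ?B)" by linarith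
    show ?thesis
    \<comment> \<open>Without oriented edges the sum over them gives no strict inequality; then
      every edge of \<open>p\<close> is blank, and there is at least one.\<close>
    proof (cases "?A = {}")
      case True
      with card len have "0 < card ?B" by (simp only: card.empty)
      with True show ?thesis by (simp only: card.empty)
    next
      case False
      then have "(\<Sum>e\<in>?A. 1) < (\<Sum>e\<in>?A. x (snd e) - x (fst e))"
        using fin(1) up by (intro sum_strict_mono) auto
      with le show ?thesis by simp
    qed
  qed
  with po show ?thesis by (simp add: semiorientations_def)
qed

lemma indeg_threshold:
  "indeg {(u, v) \<in> parcs G. x u + 1 < (x v :: real)} v = card {u \<in> parcs G `` {v}. x u + 1 < x v}"
  unfolding indeg_def by (rule arg_cong[where f = card]) (use arcs_sym in auto)

lemma outdeg_eq_degree_iff: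
  assumes "partial_orientation G \<O>"
  shows "outdeg \<O> v = out_degree (with_proj G) v \<longleftrightarrow> (\<forall>w. (v, w) \<in> parcs G \<longrightarrow> (v, w) \<in> \<O>)"
proof -
  have "{w. (v, w) \<in> \<O>} \<subseteq> parcs G `` {v}" using assms by (auto simp: partial_orientation_def)
  moreover have "{w. (v, w) \<in> \<O>} = parcs G `` {v} \<longleftrightarrow> (\<forall>w. (v, w) \<in> parcs G \<longrightarrow> (v, w) \<in> \<O>)"
    using calculation by auto
  ultimately show ?thesis
    using card_subset_eq[OF finite_neighbours] by (metis outdeg_def out_degree_with_proj)
qed

text \<open>Burning times with prescribed indegrees \<open>c + 1\<close> give the orientation; the
  bound \<open>nb\<close> is what orients every edge at \<open>v0\<close> outwards.\<close>

lemma unfirable_imp_sourced_semiorientation: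
  assumes v0: "v0 \<in> pverts G" and c: "c \<in> divisors G" "c v0 = - 1"
    and lower: "\<And>v. v \<in> pverts G \<Longrightarrow> - 1 \<le> c v"
    and nb: "\<And>v. (v0, v) \<in> parcs G \<Longrightarrow> 0 \<le> c v"
    and unfirable: "unfirable (parcs G) (pverts G) c"
  shows "\<exists>\<O> \<in> sourced_semiorientations G v0. indeg_divisor G \<O> = c"
proof -
  \<comment> \<open>The required indegree. By \<open>lower\<close> the truncation by
    \<open>nat\<close> changes nothing on vertices, and \<open>c v0 = - 1\<close> gives
    \<open>f v0 = 0\<close>, so burning can start at \<open>v0\<close>.\<close>
  define f where "f v = nat (c v + 1)" for v
  obtain x :: "'a \<Rightarrow> real" where x: "\<And>v. v \<in> pverts G \<Longrightarrow> x v0 \<le> x v"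
    "\<And>v. v \<in> pverts G \<Longrightarrow> card {u \<in> parcs G `` {v}. x u + 1 < x v} = f v"
  proof (rule burning_times[of "pverts G" "\<lambda>v. parcs G `` {v}" f v0])
    fix Y assume Y: "Y \<subseteq> pverts G" "Y \<noteq> {}"
    then obtain v where "v \<in> Y" "c v < int (card (parcs G `` {v} - Y))"
      using unfirable unfolding unfirable_def by blast
    then show "\<exists>v\<in>Y. f v \<le> card (parcs G `` {v} - Y)"
      unfolding f_def by (intro bexI[of _ v]) linarith+
  qed (use pair_finite_verts neighbours_subset v0 c(2) in \<open>auto simp: f_def\<close>)
  define \<O> where "\<O> = {(u, v) \<in> parcs G. x u + 1 < x v}"
  have semi: "\<O> \<in> semiorientations G" unfolding \<O>_def by (rule threshold_semiorientation)
  \<comment> \<open>Since \<open>f w\<close> is positive, some \<open>u\<close> burns more than one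
    time unit before \<open>w\<close>; \<open>v0\<close> burns no later than \<open>u\<close>, so
    its edge to \<open>w\<close> is oriented too.\<close>
  have "(v0, w) \<in> \<O>" if w: "(v0, w) \<in> parcs G" for w
  proof -
    have "w \<in> pverts G" using w wellformed' by blast
    then have "card {u \<in> parcs G `` {w}. x u + 1 < x w} \<noteq> 0"
      using x(2) nb[OF w] by (simp add: f_def)
    then have "{u \<in> parcs G `` {w}. x u + 1 < x w} \<noteq> {}" by (metis card.empty)
    then obtain u where "u \<in> parcs G `` {w}" "x u + 1 < x w" by blast
    moreover have "x v0 \<le> x u" using x(1) calculation(1) wellformed' by blast
    ultimately show ?thesis using w by (simp add: \<O>_def)
  qed
  with semi have "\<O> \<in> sourced_semiorientations G v0"
    using outdeg_eq_degree_iff by (auto simp: sourced_semiorientations_def semiorientations_def)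
  moreover have "indeg_divisor G \<O> v = c v" for v
  proof (cases "v \<in> pverts G")
    case True
    with x(2) lower[OF True] show ?thesis
      by (simp add: indeg_divisor_def \<O>_def indeg_threshold f_def)
  next
    case False
    with c(1) show ?thesis by (simp add: indeg_divisor_def divisors_def)
  qed
  ultimately show ?thesis by blast
qed

lemma sourced_semiorientation_indeg:
  assumes O: "\<O> \<in> sourced_semiorientations G v0"
  shows "indeg \<O> v0 = 0" and "(v0, v) \<in> parcs G \<Longrightarrow> 1 \<le> indeg \<O> v"
proof -
  have po: "partial_orientation G \<O>"
    using O by (simp add: sourced_semiorientations_def semiorientations_def)
  with O have out: "(v0, w) \<in> \<O>" if "(v0, w) \<in> parcs G" for w
    using that outdeg_eq_degree_iff by (simp add: sourced_semiorientations_def)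
  then have "{u. (u, v0) \<in> \<O>} = {}" using po arcs_sym unfolding partial_orientation_def by blast
  then show "indeg \<O> v0 = 0" by (simp add: indeg_def)
  assume "(v0, v) \<in> parcs G"
  with out have "v0 \<in> {u. (u, v) \<in> \<O>}" by simp
  moreover have "{u. (u, v) \<in> \<O>} \<subseteq> parcs G `` {v}"
    using po arcs_sym unfolding partial_orientation_def by blast
  then have "finite {u. (u, v) \<in> \<O>}" using finite_neighbours finite_subset by blast
  ultimately have "0 < card {u. (u, v) \<in> \<O>}" by (metis card_gt_0_iff empty_iff)
  then show "1 \<le> indeg \<O> v" by (simp add: indeg_def)
qed

section \<open>Superstability conditions as unfirability\<close>

lemma quasi_superstables_eq:
  "quasi_superstables G =
    {c \<in> divisors G. (\<forall>v\<in>pverts G. - 1 \<le> c v) \<and> unfirable (parcs G) (pverts G) c}"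
proof -
  have "superstable (cone G) None (case_option 0 (c + indicator (pverts G))) \<longleftrightarrow>
      (\<forall>v\<in>pverts G. - 1 \<le> c v) \<and> unfirable (parcs G) (pverts G) c" if c: "c \<in> divisors G" for c
  proof -
    let ?c = "case_option 0 (c + indicator (pverts G))"
    have fin: "finite (pverts (cone G))" using pair_finite_verts by (simp add: cone_def)
    have arcs: "parcs (cone G) \<subseteq> pverts (cone G) \<times> pverts (cone G)"
      using arcs_subset by (auto simp: cone_def)
    have verts: "pverts (cone G) - {None} = Some ` pverts G" by (auto simp: cone_def)
    have conf: "?c \<in> configurations (cone G) None"
      using c by (auto simp: configurations_def divisors_def verts image_iff split: option.split)
    have "0 \<le> ?c \<longleftrightarrow> (\<forall>v\<in>pverts G. - 1 \<le> c v)"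
    proof -
      have "0 \<le> ?c \<longleftrightarrow> (\<forall>v. 0 \<le> c v + indicator (pverts G) v)"
        unfolding le_fun_def by (subst split_option_all) simp
      also have "\<dots> \<longleftrightarrow> (\<forall>v\<in>pverts G. - 1 \<le> c v)"
        using c by (force simp: divisors_def indicator_def)
      finally show ?thesis .
    qed
    moreover have "unfirable (parcs (cone G)) (Some ` pverts G) ?c \<longleftrightarrow>
        unfirable (parcs G) (pverts G) c"
    proof -
      have "?c (Some v) < int (card (parcs (cone G) `` {Some v} - Some ` Y)) \<longleftrightarrow>
          c v < int (card (parcs G `` {v} - Y))" if "v \<in> pverts G" for v Y
      proof -
        \<comment> \<open>The sink \<open>None\<close> lies in no test set, so exactly one more edge
          leaves \<open>Y\<close> at \<open>v\<close> than in \<open>G\<close>, cancelling the shift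
          by 1.\<close>
        have "parcs (cone G) `` {Some v} - Some ` Y = insert None (Some ` (parcs G `` {v} - Y))"
          using that by (auto simp: cone_def)
        moreover have "card \<dots> = Suc (card (parcs G `` {v} - Y))"
          using finite_neighbours by (subst card_insert_disjoint) (auto simp: card_image)
        ultimately show ?thesis using that by simp
      qed
      then have "(\<exists>v\<in>Some ` Y. ?c v < int (card (parcs (cone G) `` {v} - Some ` Y))) \<longleftrightarrow>
          (\<exists>v\<in>Y. c v < int (card (parcs G `` {v} - Y)))" if "Y \<subseteq> pverts G" for Y
        using that unfolding bex_simps(7) by (intro bex_cong) auto
      then show ?thesis
        by (simp add: unfirable_def all_subset_image cong: imp_cong)
    qed
    ultimately show ?thesis
      using superstable_iff_unfirable[OF fin arcs] conf by (simp add: verts)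
  qed
  then show ?thesis by (auto simp: quasi_superstables_def)
qed

lemma superstable_join_sink_iff:
  assumes c: "c \<in> configurations G v0" and v0: "v0 \<in> pverts G"
  shows "superstable (join_sink G v0) v0 (c + indicator (non_neighbours G v0)) \<longleftrightarrow>
    - indicator (non_neighbours G v0) \<le> c \<and> unfirable (parcs G) (pverts G - {v0}) c"
proof -
  let ?X = "non_neighbours G v0" and ?H = "join_sink G v0"
  have X: "?X \<subseteq> pverts G - {v0}" by (auto simp: non_neighbours_def)
  have fin: "finite (pverts ?H)" using pair_finite_verts by (simp add: join_sink_def)
  have arcs: "parcs ?H \<subseteq> pverts ?H \<times> pverts ?H"
    using arcs_subset X v0 by (auto simp: join_sink_def)
  have verts: "pverts ?H = pverts G" by (simp add: join_sink_def)
  have conf: "c + indicator ?X \<in> configurations ?H v0"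
    using c X by (auto simp: configurations_def verts indicator_def)
  have "0 \<le> c + indicator ?X \<longleftrightarrow> - indicator ?X \<le> c"
  proof -
    have "0 \<le> c v + indicator ?X v \<longleftrightarrow> - indicator ?X v \<le> c v" for v by linarith
    then show ?thesis by (simp add: le_fun_def)
  qed
  moreover have "unfirable (parcs ?H) (pverts G - {v0}) (c + indicator ?X) \<longleftrightarrow>
      unfirable (parcs G) (pverts G - {v0}) c"
  proof -
    have "(c + indicator ?X) v < int (card (parcs ?H `` {v} - Y)) \<longleftrightarrow>
        c v < int (card (parcs G `` {v} - Y))"
      if v: "v \<in> pverts G - {v0}" and Y: "Y \<subseteq> pverts G - {v0}" for v Y
    proof (cases "v \<in> ?X")
      case True
      \<comment> \<open>Test sets avoid \<open>v0\<close>, so the edge added at \<open>v\<close>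
        counts and offsets the unit added to \<open>c v\<close>.\<close>
      then have "parcs ?H `` {v} - Y = insert v0 (parcs G `` {v} - Y)"
        using v Y X by (auto simp: join_sink_def)
      moreover have "v0 \<notin> parcs G `` {v} - Y" using True by (auto simp: non_neighbours_def)
      ultimately show ?thesis using True finite_neighbours by simp
    next
      case False
      then have "parcs ?H `` {v} - Y = parcs G `` {v} - Y"
        using v by (auto simp: join_sink_def)
      with False show ?thesis by simp
    qed
    then show ?thesis unfolding unfirable_def by (meson subsetD)
  qed
  ultimately show ?thesis
    using superstable_iff_unfirable[OF fin arcs] conf by (simp add: verts)
qed


lemma diff_sink_in_quasi_superstables_iff:
  assumes c: "c \<in> configurations G v0" and v0: "v0 \<in> pverts G"
  shows "c - indicator {v0} \<in> quasi_superstables G \<longleftrightarrow>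
    (\<forall>v\<in>pverts G. - 1 \<le> c v) \<and> unfirable (parcs G) (pverts G - {v0}) c"
proof -
  let ?d = "c - indicator {v0}"
  have c0: "c v0 = 0" using c by (auto simp: configurations_def)
  have "?d \<in> divisors G" using c v0 by (auto simp: configurations_def divisors_def indicator_def)
  moreover have "unfirable (parcs G) (pverts G) ?d \<longleftrightarrow> unfirable (parcs G) (pverts G - {v0}) ?d"
    by (rule unfirable_remove) (simp add: c0)
  moreover have "unfirable (parcs G) (pverts G - {v0}) ?d \<longleftrightarrow> unfirable (parcs G) (pverts G - {v0}) c"
    by (rule unfirable_cong) simp
  moreover have "(- 1 \<le> ?d v) \<longleftrightarrow> (- 1 \<le> c v)" for v using c0 by (cases "v = v0") simp_all
  ultimately show ?thesis by (auto simp: quasi_superstables_eq)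
qed

text \<open>Adding \<open>v0\<close> maps the divisors with value -1 at \<open>v0\<close>
  bijectively to the configurations; this puts the sets of divisors into the shifted form used in
  the theorem.\<close>

lemma sink_shift_eq:
  assumes S: "S \<subseteq> divisors G" and v0: "v0 \<in> pverts G"
  shows "{d \<in> S. d v0 = - 1 \<and> P (d + indicator {v0})} =
    {c - indicator {v0} | c. c \<in> configurations G v0 \<and> c - indicator {v0} \<in> S \<and> P c}"
    (is "?L = ?R")
proof (intro set_eqI iffI)
  fix d assume d: "d \<in> ?L"
  then have "d + indicator {v0} \<in> configurations G v0"
    using S by (auto simp: configurations_def divisors_def indicator_def)
  with d show "d \<in> ?R" by (intro CollectI exI[of _ "d + indicator {v0}"]) simp
next
  fix d assume "d \<in> ?R"
  then obtain c where c: "d = c - indicator {v0}" "c \<in> configurations G v0"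
    "c - indicator {v0} \<in> S" "P c" by blast
  then show "d \<in> ?L" by (auto simp: configurations_def)
qed

lemma quasi_superstables_subset: "quasi_superstables G \<subseteq> divisors G"
  by (auto simp: quasi_superstables_def)

lemma sink_quasi_superstables_eq:
  assumes v0: "v0 \<in> pverts G"
  shows "sink_quasi_superstables G v0 =
    {c - indicator {v0} | c. c \<in> configurations G v0 \<and>
       - indicator (non_neighbours G v0) \<le> c \<and> unfirable (parcs G) (pverts G - {v0}) c}"
proof -
  \<comment> \<open>The bound by the negated indicator entails the bound -1 that membership in
    \<open>quasi_superstables\<close> brings.\<close>
  have lower: "- 1 \<le> c v" if "- indicator (non_neighbours G v0) \<le> c" for c :: "'a \<Rightarrow> int" and v
  proof -
    have "- indicator (non_neighbours G v0) v \<le> c v" using that by (simp add: le_fun_def)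
    moreover have "- 1 \<le> - (indicator (non_neighbours G v0) v :: int)" by (simp add: indicator_def)
    ultimately show ?thesis by linarith
  qed
  show ?thesis
    unfolding sink_quasi_superstables_def
      sink_shift_eq[OF quasi_superstables_subset v0, of "(\<le>) (- indicator (non_neighbours G v0))"]
    by (intro Collect_diff_cong) (auto simp: diff_sink_in_quasi_superstables_iff[OF _ v0] dest: lower)
qed

lemma nonneg_sink_quasi_superstables_eq:
  assumes v0: "v0 \<in> pverts G"
  shows "nonneg_sink_quasi_superstables G v0 =
    {c - indicator {v0} | c. c \<in> configurations G v0 \<and>
       0 \<le> c \<and> unfirable (parcs G) (pverts G - {v0}) c}"
proof -
  have lower: "- 1 \<le> c v" if "0 \<le> c" for c :: "'a \<Rightarrow> int" and v
  proof -
    have "0 \<le> c v" using that by (simp add: le_fun_def)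
    then show ?thesis by simp
  qed
  show ?thesis
    unfolding nonneg_sink_quasi_superstables_def
      sink_shift_eq[OF quasi_superstables_subset v0, of "(\<le>) 0"]
    by (intro Collect_diff_cong) (auto simp: diff_sink_in_quasi_superstables_iff[OF _ v0] dest: lower)
qed

lemma superstable_iff:
  "superstable G v0 c \<longleftrightarrow>
    c \<in> configurations G v0 \<and> 0 \<le> c \<and> unfirable (parcs G) (pverts G - {v0}) c"
  by (rule superstable_iff_unfirable[OF pair_finite_verts arcs_subset])

lemma parking_functions_eq:
  assumes v0: "v0 \<in> pverts G"
  shows "parking_functions G v0 =
    {c - indicator {v0} | c. c \<in> configurations G v0 \<and> superstable G v0 c}"
proof -
  have "(\<lambda>v. if v = v0 then 0 else d v) = d + indicator {v0}" if "d v0 = - 1" for d :: "'a \<Rightarrow> int"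
    using that by (intro ext) (simp add: indicator_def)
  then have "parking_functions G v0 =
      {d \<in> divisors G. d v0 = - 1 \<and> superstable G v0 (d + indicator {v0})}"
    unfolding parking_functions_def by (intro Collect_cong conj_cong refl) simp
  also have "\<dots> = {c - indicator {v0} | c. c \<in> configurations G v0 \<and> superstable G v0 c}"
  proof -
    have "c - indicator {v0} \<in> divisors G" if "c \<in> configurations G v0" for c
      using that v0 by (auto simp: configurations_def divisors_def indicator_def)
    then show ?thesis
      unfolding sink_shift_eq[OF order_refl v0, of "superstable G v0"]
      by (intro Collect_diff_cong) blast
  qed
  finally show ?thesis .
qed

section \<open>Images of the indegree divisor map\<close>

text \<open>The bound reads -1 on non-neighbours and 0 on neighbours, and at \<open>v0\<close> both
  sides are 0. The neighbour bound is what edges leaving \<open>v0\<close> force on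
  indegrees.\<close>

lemma bound_non_neighbours_iff:
  assumes d: "d \<in> divisors G" "d v0 = - 1"
  shows "- indicator (non_neighbours G v0) \<le> d + indicator {v0} \<longleftrightarrow>
    (\<forall>v\<in>pverts G. - 1 \<le> d v) \<and> (\<forall>v. (v0, v) \<in> parcs G \<longrightarrow> 0 \<le> d v)" (is "?L \<longleftrightarrow> ?R")
proof -
  have "- indicator (non_neighbours G v0) v \<le> d v + indicator {v0} v \<longleftrightarrow>
      (v \<in> pverts G \<longrightarrow> - 1 \<le> d v) \<and> ((v0, v) \<in> parcs G \<longrightarrow> 0 \<le> d v)" for v
  proof (cases "v = v0 \<or> v \<notin> pverts G")
    case True
    then show ?thesis
      using d wellformed' no_loops[of "(v0, v0)"] by (auto simp: non_neighbours_def divisors_def indicator_def)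
  next
    case False
    then show ?thesis using arcs_sym[of v v0] by (auto simp: non_neighbours_def indicator_def)
  qed
  then show ?thesis by (auto simp: le_fun_def)
qed

lemma indeg_divisor_in_divisors: "indeg_divisor G \<O> \<in> divisors G"
  by (simp add: indeg_divisor_def divisors_def)

text \<open>Edges leaving \<open>v0\<close> give it indegree 0 and its neighbours indegree at least
  1; conversely, these bounds are what the burning construction asks for.\<close>

lemma indeg_divisor_sourced:
  assumes v0: "v0 \<in> pverts G"
  shows "indeg_divisor G ` sourced_semiorientations G v0 = sink_quasi_superstables G v0"
proof (intro set_eqI iffI)
  fix d assume "d \<in> indeg_divisor G ` sourced_semiorientations G v0"
  then obtain \<O> where O: "\<O> \<in> sourced_semiorientations G v0" and d: "d = indeg_divisor G \<O>"
    by blast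
  have "\<O> \<in> semiorientations G" using O by (simp add: sourced_semiorientations_def)
  then have "d \<in> quasi_superstables G"
    using unfirable_indeg_divisor indeg_divisor_in_divisors
    unfolding quasi_superstables_eq d by (auto simp: indeg_divisor_def)
  moreover have "d v0 = - 1"
    using v0 sourced_semiorientation_indeg(1)[OF O] by (simp add: d indeg_divisor_def)
  moreover have "0 \<le> d v" if "(v0, v) \<in> parcs G" for v
    using sourced_semiorientation_indeg(2)[OF O that] by (simp add: d indeg_divisor_def)
  ultimately show "d \<in> sink_quasi_superstables G v0"
    using bound_non_neighbours_iff[of d v0]
    unfolding sink_quasi_superstables_def quasi_superstables_eq by blast
next
  fix d assume "d \<in> sink_quasi_superstables G v0"
  then have "d \<in> divisors G" "d v0 = - 1" "unfirable (parcs G) (pverts G) d"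
    "- indicator (non_neighbours G v0) \<le> d + indicator {v0}"
    by (auto simp: sink_quasi_superstables_def quasi_superstables_eq)
  then have "\<exists>\<O> \<in> sourced_semiorientations G v0. indeg_divisor G \<O> = d"
    using bound_non_neighbours_iff[of d v0] v0
    by (intro unfirable_imp_sourced_semiorientation) auto
  then show "d \<in> indeg_divisor G ` sourced_semiorientations G v0" by blast
qed

lemma nonneg_sink_quasi_superstables_subset:
  "nonneg_sink_quasi_superstables G v0 \<subseteq> sink_quasi_superstables G v0"
proof -
  have "- indicator A \<le> (0 :: 'a \<Rightarrow> int)" for A by (simp add: le_fun_def)
  then show ?thesis
    unfolding nonneg_sink_quasi_superstables_def sink_quasi_superstables_def
    by (blast intro: order_trans)
qed

text \<open>Cuts both sides of the preceding equality by one condition: positive indegrees off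
  \<open>v0\<close> amount to nonnegativity after adding \<open>v0\<close>.\<close>

lemma indeg_divisor_uniquely_sourced:
  assumes v0: "v0 \<in> pverts G"
  shows "indeg_divisor G ` uniquely_sourced_semiorientations G v0 =
    nonneg_sink_quasi_superstables G v0"
proof -
  \<comment> \<open>At \<open>v0\<close> the added 1 restores the indegree, which is never negative,
    so only the other vertices impose a condition.\<close>
  have "0 \<le> indeg_divisor G \<O> + indicator {v0} \<longleftrightarrow> (\<forall>v\<in>pverts G - {v0}. 1 \<le> indeg \<O> v)" for \<O>
    by (auto simp: le_fun_def indeg_divisor_def indicator_def Suc_le_eq)
  then have "indeg_divisor G ` uniquely_sourced_semiorientations G v0 =
      {d \<in> indeg_divisor G ` sourced_semiorientations G v0. 0 \<le> d + indicator {v0}}"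
    unfolding uniquely_sourced_semiorientations_def by blast
  also have "\<dots> = {d \<in> sink_quasi_superstables G v0. 0 \<le> d + indicator {v0}}"
    by (simp add: indeg_divisor_sourced v0)
  also have "\<dots> = nonneg_sink_quasi_superstables G v0"
    using nonneg_sink_quasi_superstables_subset
    by (auto simp: nonneg_sink_quasi_superstables_def sink_quasi_superstables_def)
  finally show ?thesis .
qed

end

theorem theorem4p3:
  fixes G :: "'a pair_pre_digraph" and v0 :: 'a
  assumes "pair_graph G"
    and "Digraph_Component.connected (with_proj G)"
    and "v0 \<in> pverts G"
  shows
    "(indeg_divisor G ` sourced_semiorientations G v0 =
        {c - indicator {v0} | c. c \<in> configurations G v0 \<and>
           superstable (join_sink G v0) v0 (c + indicator (non_neighbours G v0))} \<and>
      {c - indicator {v0} | c. c \<in> configurations G v0 \<and>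
           superstable (join_sink G v0) v0 (c + indicator (non_neighbours G v0))} =
        sink_quasi_superstables G v0) \<and>
     (nonneg_sink_quasi_superstables G v0 \<subseteq> sink_quasi_superstables G v0 \<and>
      indeg_divisor G ` uniquely_sourced_semiorientations G v0 =
        {c - indicator {v0} | c. c \<in> configurations G v0 \<and> superstable G v0 c} \<and>
      {c - indicator {v0} | c. c \<in> configurations G v0 \<and> superstable G v0 c} =
        {c - indicator {v0} | c. c \<in> configurations G v0 \<and>
           superstable (join_sink G v0) v0 (c + indicator (non_neighbours G v0)) \<and> 0 \<le> c} \<and>
      {c - indicator {v0} | c. c \<in> configurations G v0 \<and>
           superstable (join_sink G v0) v0 (c + indicator (non_neighbours G v0)) \<and> 0 \<le> c} =
        nonneg_sink_quasi_superstables G v0) \<and>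
     (indeg_divisor G ` uniquely_sourced_semiorientations G v0 = parking_functions G v0 \<and>
      nonneg_sink_quasi_superstables G v0 = parking_functions G v0)"
proof -
  interpret pair_graph G by fact
  note v0 = \<open>v0 \<in> pverts G\<close>
  let ?X = "non_neighbours G v0"
  have join: "{c - indicator {v0} | c. c \<in> configurations G v0 \<and>
      superstable (join_sink G v0) v0 (c + indicator ?X)} = sink_quasi_superstables G v0"
    unfolding sink_quasi_superstables_eq[OF v0]
    by (intro Collect_diff_cong) (rule superstable_join_sink_iff[OF _ v0])
  \<comment> \<open>So on nonnegative configurations superstability on \<open>join_sink G v0\<close>
    reduces to unfirability on \<open>G\<close>.\<close>
  have "- indicator ?X \<le> c" if "0 \<le> c" for c :: "'a \<Rightarrow> int"
    using that by (rule order_trans[rotated]) (simp add: le_fun_def)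
  then have join_nonneg: "{c - indicator {v0} | c. c \<in> configurations G v0 \<and>
      superstable (join_sink G v0) v0 (c + indicator ?X) \<and> 0 \<le> c} =
      nonneg_sink_quasi_superstables G v0"
    unfolding nonneg_sink_quasi_superstables_eq[OF v0]
    by (intro Collect_diff_cong) (use superstable_join_sink_iff[OF _ v0] in blast)
  have superstable: "{c - indicator {v0} | c. c \<in> configurations G v0 \<and> superstable G v0 c} =
      nonneg_sink_quasi_superstables G v0"
    unfolding nonneg_sink_quasi_superstables_eq[OF v0]
    by (intro Collect_diff_cong) (use superstable_iff in blast)
  \<comment> \<open>Every set is rewritten to \<open>sink_quasi_superstables\<close> or
    \<open>nonneg_sink_quasi_superstables\<close>; the inclusion between these two remains.\<close>
  show ?thesis
    unfolding join join_nonneg indeg_divisor_sourced[OF v0] indeg_divisor_uniquely_sourced[OF v0]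
      parking_functions_eq[OF v0] superstable
    using nonneg_sink_quasi_superstables_subset by blast
qed

end
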